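(* Let $\mathcal V_{W\dot WM_uM_y}$ be a generalized dynamical system, $\mathcal V_{W\dot W}$ a linear subspace of vectors on $W\uplus\dot W$, and $\mathcal V_{M_uM_y}$ a linear subspace of vectors on $M_u\uplus M_y$. Then 1. $\mathcal V_{W\dot WM_uM_y}=(\mathcal V^a_{W'\dot W'M_u'M_y'})^a$. 2. $\mathcal V_{W\dot W}=\mathcal V_{W\dot WM_uM_y}\leftrightarrow\mathcal V_{M_uM_y}$ if and only if $\mathcal V^a_{W'\dot W'}=\mathcal V^a_{W'\dot W'M_u'M_y'}\leftrightarrow(\mathcal V_{M_uM_y}^\perp)_{-M_y'M_u'}$. 3. $\mathcal V_{W\dot W}=(\mathcal V^a_{W'\dot W'})^a$. 4. $\mathcal V_{W\dot W}$ is a USG if and only if $\mathcal V^a_{W'\dot W'}$ is an LSG. 5. $\mathcal V_{W\dot W}$ is a genop if and only if $\mathcal V^a_{W'\dot W'}$ is a genop. 6. $\mathcal V_{W\dot W}$ is decoupled if and only if $\mathcal V^a_{W'\dot W'}$ is decoupled.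
   Context: Fix a field $\mathbb F$; all index sets are finite. A vector on $X$ is a function $X\to\mathbb F$; for disjoint $X,Y$ a vector on $X\uplus Y$ is written $(f_X,f_Y)$. For a subspace $\mathcal V_{XY}$: $\mathcal V_{XY}\circ X:=\{f_X:(f_X,g_Y)\in\mathcal V_{XY}\text{ for some }g_Y\}$, $\mathcal V_{XY}\times X:=\{f_X:(f_X,0_Y)\in\mathcal V_{XY}\}$, and $\mathcal V_{XY}\leftrightarrow\mathcal V_Y:=\{f_X:\exists g_Y\in\mathcal V_Y,\ (f_X,g_Y)\in\mathcal V_{XY}\}$. $\mathcal V^\perp$ is the orthogonal complement with respect to the dot product $\sum_e f(e)g(e)$. Copies: sets in a given bijection are copies of each other, and vectors are transported along the bijection; $(\mathcal V_X)_{X'}$ is $\mathcal V_X$ transported to the copy $X'$. $W,\dot W$ are disjoint copies of each other. A generalized dynamical system $\mathcal V_{W\dot WM_uM_y}$ is a subspace of vectors on $W\uplus\dot W\uplus M_u\uplus M_y$; a genaut $\mathcal V_{W\dot W}$ is a subspace of vectors on $W\uplus\dot W$. A genaut is a USG if $\mathcal V_{W\dot W}\circ W\supseteq(\mathcal V_{W\dot W}\circ\dot W)_W$; an LSG if $\mathcal V_{W\dot W}\times W\supseteq(\mathcal V_{W\dot W}\times\dot W)_W$; a genop if it is both. It is decoupled if it equals $\mathcal V^1_W\oplus\mathcal V^2_{\dot W}$ for some subspaces (equivalently, its restriction and contraction to $W$ coincide and likewise for $\dot W$). Adjoint: let $W',\dot W'$ be disjoint copies of $W$ (and of $\dot W$),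 and $M_u',M_y'$ disjoint sets which are copies of $M_y,M_u$ respectively. Define $\mathcal V^a_{W'\dot W'M_u'M_y'}=(\mathcal V_{W\dot WM_uM_y})^a:=(\mathcal V^\perp_{W\dot WM_uM_y})_{-\dot W'\,W'\,-M_y'\,M_u'}$: each vector $(f_W,g_{\dot W},h_{M_u},k_{M_y})$ of $\mathcal V^\perp$ is replaced by the vector whose $\dot W'$-component is (a copy of) $-f$, $W'$-component is $g$, $M_y'$-component is $-h$, $M_u'$-component is $k$. Similarly $\mathcal V^a_{W'\dot W'}=(\mathcal V_{W\dot W})^a:=(\mathcal V_{W\dot W}^\perp)_{-\dot W'W'}$, and $(\mathcal V^\perp_{M_uM_y})_{-M_y'M_u'}$ has the analogous meaning. The adjoint of a space on the primed sets is formed by the same rule with primed and unprimed sets exchanged ($W'\mapsto-\dot W$, $\dot W'\mapsto W$, $M_u'\mapsto-M_y$, $M_y'\mapsto M_u$), giving a space on the unprimed sets. *)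

theory Defs
  imports Complex_Main "HOL-Library.Function_Algebras"
begin

text \<open>
  A vector on a set \<open>X\<close> of indices is represented by its extension by zero to the
  whole index type. For disjoint \<open>X\<close> and \<open>Y\<close>, the vector
  \<open>(f\<^sub>X, g\<^sub>Y)\<close> on \<open>X \<union> Y\<close> is therefore the pointwise sum \<open>f + g\<close>, and
  \<open>(f\<^sub>X, 0\<^sub>Y)\<close> is \<open>f\<close> itself.
\<close>

definition vecs :: "'i set \<Rightarrow> ('i \<Rightarrow> 'f::field) set" where
  "vecs X = {f. \<forall>i. i \<notin> X \<longrightarrow> f i = 0}"

definition vscale :: "'f::field \<Rightarrow> ('i \<Rightarrow> 'f) \<Rightarrow> 'i \<Rightarrow> 'f" where
  "vscale c f = (\<lambda>i. c * f i)"

lemma vector_space_vscale: "vector_space (vscale :: 'f::field \<Rightarrow> ('i \<Rightarrow> 'f) \<Rightarrow> 'i \<Rightarrow> 'f)"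
  by unfold_locales (auto simp: vscale_def fun_eq_iff plus_fun_def algebra_simps)

definition subspace_on :: "'i set \<Rightarrow> ('i \<Rightarrow> 'f::field) set \<Rightarrow> bool" where
  "subspace_on X V \<longleftrightarrow> V \<subseteq> vecs X \<and> module.subspace vscale V"

definition perp :: "'i set \<Rightarrow> ('i \<Rightarrow> 'f::field) set \<Rightarrow> ('i \<Rightarrow> 'f) set" where
  "perp E V = {f \<in> vecs E. \<forall>g\<in>V. (\<Sum>e\<in>E. f e * g e) = 0}"

text \<open>
  In the next three definitions \<open>V\<close> is a space on \<open>X \<union> Y\<close> with \<open>X\<close> and \<open>Y\<close> disjoint:
  the restriction \<open>V \<circ> X\<close>, the contraction \<open>V \<times> X\<close> and the matched composition
  \<open>V \<leftrightarrow> K\<close> with a space \<open>K\<close> on \<open>Y\<close>.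
\<close>

definition restriction :: "'i set \<Rightarrow> 'i set \<Rightarrow> ('i \<Rightarrow> 'f::field) set \<Rightarrow> ('i \<Rightarrow> 'f) set" where
  "restriction X Y V = {f \<in> vecs X. \<exists>g\<in>vecs Y. f + g \<in> V}"

definition contraction :: "'i set \<Rightarrow> ('i \<Rightarrow> 'f::field) set \<Rightarrow> ('i \<Rightarrow> 'f) set" where
  "contraction X V = {f \<in> vecs X. f \<in> V}"

definition matched_comp ::
  "'i set \<Rightarrow> ('i \<Rightarrow> 'f::field) set \<Rightarrow> ('i \<Rightarrow> 'f) set \<Rightarrow> ('i \<Rightarrow> 'f) set" where
  "matched_comp X V K = {f \<in> vecs X. \<exists>g\<in>K. f + g \<in> V}"

text \<open>Transport of a vector on \<open>X\<close> along a map \<open>\<phi>\<close> that is injective on \<open>X\<close>, to the copy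
  \<open>\<phi> ` X\<close>.\<close>

definition transport :: "('i \<Rightarrow> 'j) \<Rightarrow> 'i set \<Rightarrow> ('i \<Rightarrow> 'f::field) \<Rightarrow> 'j \<Rightarrow> 'f" where
  "transport \<phi> X f = (\<lambda>j. if j \<in> \<phi> ` X then f (inv_into X \<phi> j) else 0)"

text \<open>
  In what follows \<open>Wd\<close> plays the role of the dotted copy of \<open>W\<close>, and
  \<open>\<sigma>\<close> is the bijection from \<open>W\<close> to \<open>Wd\<close>.
\<close>

definition gds :: "'i set \<Rightarrow> 'i set \<Rightarrow> 'i set \<Rightarrow> 'i set \<Rightarrow> ('i \<Rightarrow> 'f::field) set \<Rightarrow> bool" where
  "gds W Wd Mu My V \<longleftrightarrow> subspace_on (W \<union> Wd \<union> Mu \<union> My) V"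

definition genaut :: "'i set \<Rightarrow> 'i set \<Rightarrow> ('i \<Rightarrow> 'f::field) set \<Rightarrow> bool" where
  "genaut W Wd A \<longleftrightarrow> subspace_on (W \<union> Wd) A"

definition usg :: "'i set \<Rightarrow> 'i set \<Rightarrow> ('i \<Rightarrow> 'i) \<Rightarrow> ('i \<Rightarrow> 'f::field) set \<Rightarrow> bool" where
  "usg W Wd \<sigma> A \<longleftrightarrow> genaut W Wd A \<and>
     transport (inv_into W \<sigma>) Wd ` restriction Wd W A \<subseteq> restriction W Wd A"

definition lsg :: "'i set \<Rightarrow> 'i set \<Rightarrow> ('i \<Rightarrow> 'i) \<Rightarrow> ('i \<Rightarrow> 'f::field) set \<Rightarrow> bool" where
  "lsg W Wd \<sigma> A \<longleftrightarrow> genaut W Wd A \<and>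
     transport (inv_into W \<sigma>) Wd ` contraction Wd A \<subseteq> contraction W A"

definition genop :: "'i set \<Rightarrow> 'i set \<Rightarrow> ('i \<Rightarrow> 'i) \<Rightarrow> ('i \<Rightarrow> 'f::field) set \<Rightarrow> bool" where
  "genop W Wd \<sigma> A \<longleftrightarrow> usg W Wd \<sigma> A \<and> lsg W Wd \<sigma> A"

definition decoupled :: "'i set \<Rightarrow> 'i set \<Rightarrow> ('i \<Rightarrow> 'f::field) set \<Rightarrow> bool" where
  "decoupled W Wd A \<longleftrightarrow>
     (\<exists>V1 V2. subspace_on W V1 \<and> subspace_on Wd V2 \<and> A = {f + g | f g. f \<in> V1 \<and> g \<in> V2})"

text \<open>
  For bijections \<open>\<phi>\<close> from \<open>X\<close> to \<open>Y'\<close> and \<open>\<psi>\<close> from \<open>Y\<close> to \<open>X'\<close>, \<open>signed_swap\<close> sends a space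
  on \<open>X \<union> Y\<close> to one on \<open>X' \<union> Y'\<close>: \<open>(f\<^sub>X, g\<^sub>Y)\<close> becomes the vector with \<open>Y'\<close>-component \<open>-f\<close>
  and \<open>X'\<close>-component \<open>g\<close>. With \<open>X = W\<close>, \<open>Y = Wd\<close> this is the operation with subscript
  \<open>-Wd' W'\<close>; with \<open>X = Mu\<close>, \<open>Y = My\<close> it is the one with subscript \<open>-My' Mu'\<close>.
\<close>

definition signed_swap :: "'i set \<Rightarrow> 'i set \<Rightarrow> ('i \<Rightarrow> 'j) \<Rightarrow> ('i \<Rightarrow> 'j) \<Rightarrow>
    ('i \<Rightarrow> 'f::field) set \<Rightarrow> ('j \<Rightarrow> 'f) set" where
  "signed_swap X Y \<phi> \<psi> V =
     {- transport \<phi> X f + transport \<psi> Y g | f g. f \<in> vecs X \<and> g \<in> vecs Y \<and> f + g \<in> V}"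

definition genaut_adjoint :: "'i set \<Rightarrow> 'i set \<Rightarrow> ('i \<Rightarrow> 'j) \<Rightarrow> ('i \<Rightarrow> 'j) \<Rightarrow>
    ('i \<Rightarrow> 'f::field) set \<Rightarrow> ('j \<Rightarrow> 'f) set" where
  "genaut_adjoint W Wd \<phi> \<psi> A = signed_swap W Wd \<phi> \<psi> (perp (W \<union> Wd) A)"

text \<open>
  Here \<open>\<phi>\<close> maps \<open>W\<close> to \<open>Wd'\<close>, \<open>\<psi>\<close> maps \<open>Wd\<close> to \<open>W'\<close>, \<open>\<alpha>\<close> maps \<open>Mu\<close> to \<open>My'\<close> and
  \<open>\<beta>\<close> maps \<open>My\<close> to \<open>Mu'\<close>.
\<close>

definition gds_adjoint :: "'i set \<Rightarrow> 'i set \<Rightarrow> 'i set \<Rightarrow> 'i set \<Rightarrow>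
    ('i \<Rightarrow> 'j) \<Rightarrow> ('i \<Rightarrow> 'j) \<Rightarrow> ('i \<Rightarrow> 'j) \<Rightarrow> ('i \<Rightarrow> 'j) \<Rightarrow>
    ('i \<Rightarrow> 'f::field) set \<Rightarrow> ('j \<Rightarrow> 'f) set" where
  "gds_adjoint W Wd Mu My \<phi> \<psi> \<alpha> \<beta> V =
     {- transport \<phi> W f + transport \<psi> Wd g - transport \<alpha> Mu h + transport \<beta> My k | f g h k.
        f \<in> vecs W \<and> g \<in> vecs Wd \<and> h \<in> vecs Mu \<and> k \<in> vecs My \<and>
        f + g + h + k \<in> perp (W \<union> Wd \<union> Mu \<union> My) V}"

end

theory Submission
  imports Defs
begin

text \<open>
  Everything reduces to two facts. First, the dot product on a finite index set is nondegenerate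
  in the strong sense that \<open>V\<^sup>\<bottom>\<^sup>\<bottom> = V\<close> for each subspace (\<open>perp_perp\<close>), over any field and although
  isotropic vectors may exist. Second, the relabelling with signs that enters an adjoint is an
  isometry \<open>J\<close> for the dot product, so that the adjoint of \<open>V\<close> is \<open>J V\<^sup>\<bottom>\<close> and \<open>J\<close> commutes with taking
  orthogonal complements (\<open>perp_image\<close>).

  The relabelling \<open>J'\<close> in the opposite direction satisfies \<open>J' J = - 1\<close>, as each coordinate passes
  exactly one of its two moves with a minus sign. Since subspaces are stable under negation, the
  adjoint of the adjoint is \<open>J' (J V\<^sup>\<bottom>)\<^sup>\<bottom> = J' J V\<^sup>\<bottom>\<^sup>\<bottom> = V\<close> (\<open>adjoint_adjoint\<close>).

  For compositions the point is \<open>(V \<leftrightarrow> K)\<^sup>\<bottom> = V\<^sup>\<bottom> \<leftrightarrow> K\<^sup>\<bottom>\<close> (\<open>perp_matched_comp\<close>). It follows from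
  the duality of restriction and contraction, \<open>(V \<circ> X)\<^sup>\<bottom> = V\<^sup>\<bottom> \<times> X\<close>, together with
  \<open>(U \<inter> V)\<^sup>\<bottom> = U\<^sup>\<bottom> + V\<^sup>\<bottom>\<close>. The map \<open>J\<close> carries compositions to compositions, and both
  \<open>V \<mapsto> V\<^sup>\<bottom>\<close> and \<open>J\<close> are injective on subspaces.

  Restriction and contraction being dual, taking orthogonal complements in the inclusion that
  defines a USG reverses it and gives the inclusion that defines an LSG, now for the adjoint
  (\<open>usg_iff_lsg_adjoint\<close>). Applied to the adjoint in place of the original space, this also exchanges
  LSG and USG, whence the claim on genops. Finally, the complement of a direct sum of spaces on
  \<open>W\<close> and \<open>Wd\<close> is the direct sum of the complements, which \<open>J\<close> moves to \<open>Wd'\<close> and \<open>W'\<close>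
  (\<open>decoupled_adjoint\<close>).
\<close>

interpretation vecs: vector_space "vscale :: 'f::field \<Rightarrow> ('i \<Rightarrow> 'f) \<Rightarrow> 'i \<Rightarrow> 'f"
  by (rule vector_space_vscale)

section \<open>Vectors, dot product and subspaces\<close>

definition dot :: "'i set \<Rightarrow> ('i \<Rightarrow> 'f::field) \<Rightarrow> ('i \<Rightarrow> 'f) \<Rightarrow> 'f" where
  "dot E f g = (\<Sum>e\<in>E. f e * g e)"

definition cut :: "'i set \<Rightarrow> ('i \<Rightarrow> 'f::field) \<Rightarrow> 'i \<Rightarrow> 'f" where
  "cut X f = (\<lambda>i. if i \<in> X then f i else 0)"

lemma perp_iff: "f \<in> perp E V \<longleftrightarrow> f \<in> vecs E \<and> (\<forall>g\<in>V. dot E f g = 0)"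
  by (simp add: perp_def dot_def)

lemma perp_subset_vecs: "perp E V \<subseteq> vecs E"
  by (auto simp: perp_def)

lemma dot_commute: "dot E f g = dot E g f"
  by (simp add: dot_def mult.commute)

lemma dot_add_left: "dot E (f + g) h = dot E f h + dot E g h"
  by (simp add: dot_def algebra_simps sum.distrib)

lemma dot_add_right: "dot E h (f + g) = dot E h f + dot E h g"
  by (simp add: dot_def algebra_simps sum.distrib)

lemma dot_zero_left [simp]: "dot E 0 h = 0"
  by (simp add: dot_def)

lemma dot_scale_left: "dot E (vscale c f) h = c * dot E f h"
  by (simp add: dot_def vscale_def sum_distrib_left mult.assoc)

lemma dot_Un:
  "\<lbrakk>finite X; finite Y; X \<inter> Y = {}\<rbrakk> \<Longrightarrow> dot (X \<union> Y) f g = dot X f g + dot Y f g"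
  unfolding dot_def by (rule sum.union_disjoint)

lemma dot_disjoint_left: "\<lbrakk>f \<in> vecs X; X \<inter> Y = {}\<rbrakk> \<Longrightarrow> dot Y f g = 0"
  unfolding dot_def vecs_def by (rule sum.neutral) auto

lemma dot_disjoint_right: "\<lbrakk>g \<in> vecs X; X \<inter> Y = {}\<rbrakk> \<Longrightarrow> dot Y f g = 0"
  by (metis dot_commute dot_disjoint_left)

lemma dot_cut: "dot X (cut X f) g = dot X f g"
  unfolding dot_def cut_def by (rule sum.cong) auto

lemma vecs_mono: "X \<subseteq> Y \<Longrightarrow> vecs X \<subseteq> vecs Y"
  by (auto simp: vecs_def)

lemma subspace_vecs: "vecs.subspace (vecs X)"
  by (rule vecs.subspaceI) (auto simp: vecs_def vscale_def)

lemma vecs_add: "\<lbrakk>f \<in> vecs X; g \<in> vecs X\<rbrakk> \<Longrightarrow> f + g \<in> vecs X"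
  by (auto simp: vecs_def)

lemma cut_in_vecs [simp]: "cut X f \<in> vecs X"
  by (auto simp: vecs_def cut_def)

lemma cut_id: "f \<in> vecs X \<Longrightarrow> cut X f = f"
  by (auto simp: vecs_def cut_def fun_eq_iff)

lemma cut_add_cut: "\<lbrakk>f \<in> vecs (X \<union> Y); X \<inter> Y = {}\<rbrakk> \<Longrightarrow> cut X f + cut Y f = f"
  by (auto simp: vecs_def cut_def fun_eq_iff)

lemma subspace_on_uminus: "\<lbrakk>subspace_on X V; f \<in> V\<rbrakk> \<Longrightarrow> - f \<in> V"
  unfolding subspace_on_def by (blast intro: vecs.subspace_neg)

lemma uminus_image_subspace:
  assumes "subspace_on X V" shows "uminus ` V = V"
proof -
  have "f \<in> uminus ` V" if "f \<in> V" for f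
    using subspace_on_uminus[OF assms that] by (metis image_eqI minus_minus)
  thus ?thesis using subspace_on_uminus[OF assms] by blast
qed

lemma subspace_on_perp: "subspace_on E (perp E V)"
  unfolding subspace_on_def
proof
  show "vecs.subspace (perp E V)"
    by (intro vecs.subspaceI)
      (auto simp: perp_iff dot_add_left dot_scale_left vecs.subspace_0[OF subspace_vecs]
        vecs.subspace_add[OF subspace_vecs] vecs.subspace_scale[OF subspace_vecs])
qed (rule perp_subset_vecs)

lemma perp_antimono: "V \<subseteq> U \<Longrightarrow> perp E U \<subseteq> perp E V"
  by (auto simp: perp_def)

text \<open>The representing vector lists the values of the functional at the unit vectors.\<close>

lemma functional_is_dot:
  fixes l :: "('i \<Rightarrow> 'f::field) \<Rightarrow> 'f"
  assumes "finite E" and l: "Vector_Spaces.linear vscale (*) l"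
  shows "\<exists>a\<in>vecs E. \<forall>y\<in>vecs E. dot E a y = l y"
proof
  interpret l: Vector_Spaces.linear vscale "(*)" l by (rule l)
  define u :: "'i \<Rightarrow> 'i \<Rightarrow> 'f" where "u i = (\<lambda>j. if j = i then 1 else 0)" for i
  let ?a = "cut E (\<lambda>i. l (u i))"
  show "?a \<in> vecs E" by simp
  show "\<forall>y\<in>vecs E. dot E ?a y = l y"
  proof
    fix y :: "'i \<Rightarrow> 'f" assume y: "y \<in> vecs E"
    have "y = (\<Sum>i\<in>E. vscale (y i) (u i))"
    proof
      fix j
      have "(\<Sum>i\<in>E. vscale (y i) (u i)) j = (\<Sum>i\<in>E. vscale (y i) (u i) j)"
        by (induction E rule: infinite_finite_induct) auto
      also have "\<dots> = (\<Sum>i\<in>E. if j = i then y i else 0)"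
        by (rule sum.cong) (auto simp: vscale_def u_def)
      also have "\<dots> = y j"
        using y \<open>finite E\<close> by (auto simp: vecs_def)
      finally show "y j = (\<Sum>i\<in>E. vscale (y i) (u i)) j" by simp
    qed
    hence "l y = (\<Sum>i\<in>E. y i * l (u i))"
      by (metis (no_types, lifting) l.sum l.scale sum.cong)
    also have "\<dots> = dot E ?a y"
      unfolding dot_def cut_def by (rule sum.cong) auto
    finally show "dot E ?a y = l y" by simp
  qed
qed

text \<open>Adding \<open>x\<close> to a basis of \<open>V\<close> keeps it independent, so a functional can be prescribed on it:
  \<open>1\<close> at \<open>x\<close> and \<open>0\<close> at the basis.\<close>

lemma separating_functional:
  fixes V :: "('i \<Rightarrow> 'f::field) set"
  assumes V: "vecs.subspace V" and x: "x \<notin> V"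
  obtains l where "Vector_Spaces.linear vscale (*) l" "\<And>y. y \<in> V \<Longrightarrow> l y = (0::'f)" "l x = 1"
proof -
  interpret scalar: vector_space "(*) :: 'f \<Rightarrow> 'f \<Rightarrow> 'f"
    by unfold_locales (auto simp: algebra_simps)
  interpret pair: vector_space_pair "vscale :: 'f \<Rightarrow> ('i \<Rightarrow> 'f) \<Rightarrow> 'i \<Rightarrow> 'f" "(*) :: 'f \<Rightarrow> 'f \<Rightarrow> 'f" ..
  obtain B where B: "B \<subseteq> V" "vecs.independent B" "V \<subseteq> vecs.span B"
    by (rule vecs.maximal_independent_subset)
  have x': "x \<notin> vecs.span B"
    using x vecs.span_minimal[OF B(1) V] by blast
  hence "vecs.independent (insert x B)"
    using B(2) by (simp add: vecs.independent_insertI)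
  from pair.linear_independent_extend[OF this, of "\<lambda>y. if y = x then 1 else 0"]
  obtain l where l: "Vector_Spaces.linear vscale (*) l"
      "\<And>y. y \<in> insert x B \<Longrightarrow> l y = (if y = x then 1 else 0)"
    by blast
  have "l y = 0" if "y \<in> V" for y
  proof (rule pair.linear_eq_0_on_span[OF l(1)])
    show "y \<in> vecs.span B" using that B by blast
    show "l b = 0" if "b \<in> B" for b
      using l(2)[of b] that x' vecs.span_base[of x B] by auto
  qed
  with l show thesis by (intro that[of l]) auto
qed

text \<open>A vector outside \<open>V\<close> is separated from \<open>V\<close> by a functional, which is the dot product with
  some element of \<open>V\<^sup>\<bottom>\<close>.\<close>

lemma perp_perp:
  assumes "finite E" and V: "subspace_on E V"
  shows "perp E (perp E V) = V"
proof
  show "V \<subseteq> perp E (perp E V)"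
  proof
    fix x assume "x \<in> V"
    moreover have "dot E x g = 0" if "g \<in> perp E V" for g
      using that \<open>x \<in> V\<close> by (simp add: perp_iff dot_commute[of E x])
    ultimately show "x \<in> perp E (perp E V)"
      using V by (auto simp: perp_iff[of x] subspace_on_def)
  qed
  show "perp E (perp E V) \<subseteq> V"
  proof (rule ccontr)
    assume "\<not> perp E (perp E V) \<subseteq> V"
    then obtain x where x: "x \<in> perp E (perp E V)" "x \<notin> V" by blast
    obtain l where l: "Vector_Spaces.linear vscale (*) l" "\<And>y. y \<in> V \<Longrightarrow> l y = 0" "l x = 1"
      using V x(2) separating_functional unfolding subspace_on_def by metis
    from functional_is_dot[OF \<open>finite E\<close> l(1)] obtain a
      where a: "a \<in> vecs E" "\<And>y. y \<in> vecs E \<Longrightarrow> dot E a y = l y" by blast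
    have "a \<in> perp E V"
      using V a l(2) by (auto simp: perp_iff subspace_on_def)
    hence "dot E x a = 0" using x(1) by (simp add: perp_iff)
    thus False using a(2)[of x] x(1) l(3) by (simp add: perp_iff dot_commute[of E a])
  qed
qed

lemma perp_subset_iff:
  assumes "finite E" "subspace_on E U" "subspace_on E V"
  shows "perp E U \<subseteq> perp E V \<longleftrightarrow> V \<subseteq> U"
  using assms by (metis perp_antimono perp_perp)

lemma perp_eq_iff:
  assumes "finite E" "subspace_on E U" "subspace_on E V"
  shows "perp E U = perp E V \<longleftrightarrow> U = V"
  using assms by (metis perp_perp)

section \<open>Orthogonal complements of minors and compositions\<close>

lemma subspace_on_restriction:
  assumes "subspace_on (X \<union> Y) V"
  shows "subspace_on X (restriction X Y V)"
proof -
  have V: "vecs.subspace V" using assms by (simp add: subspace_on_def)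
  have "vecs.subspace (restriction X Y V)"
  proof (rule vecs.subspaceI)
    show "0 \<in> restriction X Y V"
      using vecs.subspace_0[OF V] vecs.subspace_0[OF subspace_vecs]
      by (auto simp: restriction_def intro: bexI[of _ 0])
  next
    fix f g assume "f \<in> restriction X Y V" "g \<in> restriction X Y V"
    then obtain a b where *: "f \<in> vecs X" "g \<in> vecs X" "a \<in> vecs Y" "b \<in> vecs Y" "f + a \<in> V" "g + b \<in> V"
      by (auto simp: restriction_def)
    have "(f + g) + (a + b) \<in> V"
      using vecs.subspace_add[OF V *(5,6)] by (simp add: algebra_simps)
    thus "f + g \<in> restriction X Y V" using * vecs_add by (auto simp: restriction_def)
  next
    fix c f assume "f \<in> restriction X Y V"
    then obtain a where *: "f \<in> vecs X" "a \<in> vecs Y" "f + a \<in> V"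
      by (auto simp: restriction_def)
    have "vscale c f + vscale c a \<in> V"
      using vecs.subspace_scale[OF V *(3)] by (simp add: vecs.scale_right_distrib)
    thus "vscale c f \<in> restriction X Y V"
      using * vecs.subspace_scale[OF subspace_vecs] by (auto simp: restriction_def)
  qed
  thus ?thesis by (auto simp: subspace_on_def restriction_def)
qed

text \<open>A vector on \<open>X\<close> has the same dot product with an element of \<open>V\<close> as with the \<open>X\<close>-part of
  that element.\<close>

lemma perp_restriction:
  assumes "finite X" "finite Y" "X \<inter> Y = {}" "V \<subseteq> vecs (X \<union> Y)"
  shows "perp X (restriction X Y V) = contraction X (perp (X \<union> Y) V)"
proof -
  have dot: "dot (X \<union> Y) f (g + h) = dot X f g"
    if "f \<in> vecs X" "h \<in> vecs Y" for f g h :: "'a \<Rightarrow> 'b"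
    using that assms(1-3)
    by (simp add: dot_Un dot_add_right dot_disjoint_left dot_disjoint_right Int_commute)
  have cut: "dot (X \<union> Y) f v = dot X f (cut X v)" "cut X v \<in> restriction X Y V"
    if "f \<in> vecs X" "v \<in> V" for f v
  proof -
    have v: "cut X v + cut Y v = v" using that assms by (blast intro: cut_add_cut)
    show "dot (X \<union> Y) f v = dot X f (cut X v)"
      using dot[OF that(1), of "cut Y v" "cut X v"] by (simp add: v)
    show "cut X v \<in> restriction X Y V"
      using v that by (auto simp: restriction_def intro: bexI[of _ "cut Y v"])
  qed
  have "(\<forall>g\<in>restriction X Y V. dot X f g = 0) \<longleftrightarrow> (\<forall>v\<in>V. dot (X \<union> Y) f v = 0)"
    if "f \<in> vecs X" for f
    using cut[OF that] dot[OF that] by (fastforce simp: restriction_def)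
  thus ?thesis
    using vecs_mono[of X "X \<union> Y"] by (auto simp: perp_iff contraction_def)
qed

definition sum_space :: "('i \<Rightarrow> 'f::field) set \<Rightarrow> ('i \<Rightarrow> 'f) set \<Rightarrow> ('i \<Rightarrow> 'f) set" where
  "sum_space U V = {f + g | f g. f \<in> U \<and> g \<in> V}"

lemma subspace_on_sum_space:
  assumes "subspace_on E U" "subspace_on E V"
  shows "subspace_on E (sum_space U V)"
  using assms vecs.subspace_sums[of U V] vecs_add
  unfolding subspace_on_def sum_space_def by blast

lemma perp_sum_space:
  assumes "0 \<in> U" "0 \<in> V"
  shows "perp E (sum_space U V) = perp E U \<inter> perp E V"
proof -
  have "f \<in> sum_space U V" if "f \<in> U" for f
    using that assms(2) unfolding sum_space_def by (metis (mono_tags, lifting) add.right_neutral mem_Collect_eq)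
  moreover have "f \<in> sum_space U V" if "f \<in> V" for f
    using that assms(1) unfolding sum_space_def by (metis (mono_tags, lifting) add.left_neutral mem_Collect_eq)
  ultimately show ?thesis
    by (fastforce simp: perp_iff sum_space_def dot_add_right)
qed

lemma subspace_on_0: "subspace_on E V \<Longrightarrow> 0 \<in> V"
  by (auto simp: subspace_on_def vecs.subspace_0)

text \<open>By double complements this is the elementary rule \<open>perp_sum_space\<close>, read for the complements
  of \<open>U\<close> and \<open>V\<close>.\<close>

lemma perp_Int:
  assumes "finite E" "subspace_on E U" "subspace_on E V"
  shows "perp E (U \<inter> V) = sum_space (perp E U) (perp E V)"
proof -
  have "U \<inter> V = perp E (sum_space (perp E U) (perp E V))"
    using assms by (simp add: perp_sum_space subspace_on_0[OF subspace_on_perp] perp_perp)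
  thus ?thesis
    using assms(1) by (simp add: perp_perp subspace_on_sum_space subspace_on_perp)
qed

lemma subspace_on_mono: "\<lbrakk>subspace_on X V; X \<subseteq> Y\<rbrakk> \<Longrightarrow> subspace_on Y V"
  using vecs_mono unfolding subspace_on_def by (metis subset_trans)

lemma perp_direct_sum:
  assumes fin: "finite X" "finite Y" and disj: "X \<inter> Y = {}"
    and U: "subspace_on X U" and V: "subspace_on Y V"
  shows "perp (X \<union> Y) (sum_space U V) = sum_space (perp X U) (perp Y V)"
proof (intro equalityI subsetI)
  fix f assume "f \<in> perp (X \<union> Y) (sum_space U V)"
  hence f: "f \<in> perp (X \<union> Y) U" "f \<in> perp (X \<union> Y) V"
    using perp_sum_space subspace_on_0 U V by blast+
  have "dot X f g = 0" if "g \<in> U" for g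
  proof -
    have "g \<in> vecs X" using that U by (auto simp: subspace_on_def)
    thus ?thesis using f(1) that fin disj by (auto simp: perp_iff dot_Un dot_disjoint_right)
  qed
  hence "cut X f \<in> perp X U" by (simp add: perp_iff dot_cut)
  moreover have "dot Y f g = 0" if "g \<in> V" for g
  proof -
    have "g \<in> vecs Y" using that V by (auto simp: subspace_on_def)
    thus ?thesis
      using f(2) that fin disj by (auto simp: perp_iff dot_Un dot_disjoint_right Int_commute)
  qed
  hence "cut Y f \<in> perp Y V" by (simp add: perp_iff dot_cut)
  moreover have "f = cut X f + cut Y f" using f disj by (simp add: cut_add_cut perp_iff)
  ultimately show "f \<in> sum_space (perp X U) (perp Y V)" unfolding sum_space_def by blast
next
  fix h assume "h \<in> sum_space (perp X U) (perp Y V)"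
  then obtain f g where h: "h = f + g" "f \<in> perp X U" "g \<in> perp Y V"
    by (auto simp: sum_space_def)
  have "dot (X \<union> Y) h (u + v) = 0" if uv: "u \<in> U" "v \<in> V" for u v
  proof -
    have in_vecs: "f \<in> vecs X" "g \<in> vecs Y" "u \<in> vecs X" "v \<in> vecs Y"
      using h uv U V by (auto simp: perp_iff subspace_on_def)
    show ?thesis
      using h uv in_vecs fin disj
      by (simp add: dot_Un dot_add_left dot_add_right perp_iff dot_disjoint_left
          dot_disjoint_right Int_commute)
  qed
  moreover have "h \<in> vecs (X \<union> Y)"
    using h vecs_mono[of X "X \<union> Y"] vecs_mono[of Y "X \<union> Y"]
    by (auto simp: perp_iff intro!: vecs_add)
  ultimately show "h \<in> perp (X \<union> Y) (sum_space U V)"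
    by (auto simp: perp_iff sum_space_def)
qed

lemma perp_vecs: "finite X \<Longrightarrow> perp X (vecs X) = {0}"
proof -
  assume "finite X"
  moreover have "subspace_on X {0}"
    unfolding subspace_on_def using vecs.subspace_0[OF subspace_vecs, of X] vecs.subspace_single_0 by simp
  moreover have "perp X {0} = vecs X"
    by (auto simp: perp_def)
  ultimately show ?thesis using perp_perp by metis
qed

text \<open>Matching with \<open>K\<close> is intersecting with the space of all vectors whose \<open>Y\<close>-part lies in \<open>K\<close>,
  followed by forgetting \<open>Y\<close>. In this form complements can be taken one operation at a time.\<close>

lemma matched_comp_eq_restriction:
  assumes "subspace_on Y K" "X \<inter> Y = {}"
  shows "matched_comp X V K = restriction X Y (V \<inter> sum_space (vecs X) K)"
proof -
  have "g \<in> K" if "f \<in> vecs X" "g \<in> vecs Y" "f + g = a + b" "a \<in> vecs X" "b \<in> K" for f g a b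
  proof -
    have b: "b \<in> vecs Y" using that assms by (auto simp: subspace_on_def)
    have "cut Y (u + v) = v" if "u \<in> vecs X" "v \<in> vecs Y" for u v :: "'a \<Rightarrow> 'b"
      using that assms(2) by (auto simp: vecs_def cut_def fun_eq_iff)
    hence "g = b" using that b by metis
    with that show ?thesis by simp
  qed
  moreover have "K \<subseteq> vecs Y" using assms by (simp add: subspace_on_def)
  ultimately show ?thesis
    unfolding matched_comp_def restriction_def sum_space_def by blast
qed

text \<open>With the composition written as a restriction, its complement is the part on \<open>X\<close> of
  \<open>V\<^sup>\<bottom> + K\<^sup>\<bottom>\<close>. Now \<open>f = v + k\<close> with \<open>v \<in> V\<^sup>\<bottom>\<close> and \<open>k \<in> K\<^sup>\<bottom>\<close> says that \<open>f - k \<in> V\<^sup>\<bottom>\<close>, and the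
  sign of \<open>k\<close> is immaterial in a subspace.\<close>

lemma
  assumes fin: "finite X" "finite Y" and disj: "X \<inter> Y = {}"
    and V: "subspace_on (X \<union> Y) V" and K: "subspace_on Y K"
  shows subspace_on_matched_comp: "subspace_on X (matched_comp X V K)"
    and perp_matched_comp:
      "perp X (matched_comp X V K) = matched_comp X (perp (X \<union> Y) V) (perp Y K)"
proof -
  have X: "subspace_on X (vecs X)" by (simp add: subspace_on_def subspace_vecs)
  have XK: "subspace_on (X \<union> Y) (sum_space (vecs X) K)"
    using X K by (intro subspace_on_sum_space) (auto intro: subspace_on_mono)
  hence I: "subspace_on (X \<union> Y) (V \<inter> sum_space (vecs X) K)"
    using V by (auto simp: subspace_on_def vecs.subspace_inter)
  show "subspace_on X (matched_comp X V K)"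
    using I K disj by (simp add: matched_comp_eq_restriction subspace_on_restriction)
  have "perp (X \<union> Y) (sum_space (vecs X) K) = perp Y K"
    using perp_direct_sum[OF fin disj X K] fin(1) by (auto simp: sum_space_def perp_vecs)
  hence "perp (X \<union> Y) (V \<inter> sum_space (vecs X) K) = sum_space (perp (X \<union> Y) V) (perp Y K)"
    using fin V XK by (simp add: perp_Int)
  moreover have "perp X (matched_comp X V K)
      = contraction X (perp (X \<union> Y) (V \<inter> sum_space (vecs X) K))"
    unfolding matched_comp_eq_restriction[OF K disj]
    using fin disj I by (intro perp_restriction) (auto simp: subspace_on_def)
  ultimately have "perp X (matched_comp X V K)
      = contraction X (sum_space (perp (X \<union> Y) V) (perp Y K))" by simp
  also have "\<dots> = matched_comp X (perp (X \<union> Y) V) (perp Y K)"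
  proof -
    have "(\<exists>v k. f = v + k \<and> v \<in> perp (X \<union> Y) V \<and> k \<in> perp Y K) \<longleftrightarrow>
        (\<exists>k\<in>perp Y K. f + k \<in> perp (X \<union> Y) V)" for f
    proof
      assume "\<exists>v k. f = v + k \<and> v \<in> perp (X \<union> Y) V \<and> k \<in> perp Y K"
      then obtain v k where "f = v + k" "v \<in> perp (X \<union> Y) V" "k \<in> perp Y K" by blast
      thus "\<exists>k\<in>perp Y K. f + k \<in> perp (X \<union> Y) V"
        using subspace_on_uminus[OF subspace_on_perp] by (intro bexI[of _ "- k"]) auto
    next
      assume "\<exists>k\<in>perp Y K. f + k \<in> perp (X \<union> Y) V"
      then obtain k where "k \<in> perp Y K" "f + k \<in> perp (X \<union> Y) V" by blast
      thus "\<exists>v k. f = v + k \<and> v \<in> perp (X \<union> Y) V \<and> k \<in> perp Y K"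
        using subspace_on_uminus[OF subspace_on_perp]
        by (intro exI[of _ "f + k"] exI[of _ "- k"]) auto
    qed
    thus ?thesis by (simp add: contraction_def matched_comp_def sum_space_def)
  qed
  finally show "perp X (matched_comp X V K) = matched_comp X (perp (X \<union> Y) V) (perp Y K)" .
qed

section \<open>Isometries between spaces of vectors\<close>

text \<open>The map \<open>T\<close> is defined on vectors on the whole index type but reads only the coordinates in
  \<open>X\<close>. Therefore isometries on disjoint sets are combined by adding them pointwise.\<close>

locale vecs_isometry =
  fixes X :: "'i set" and X' :: "'j set" and T :: "('i \<Rightarrow> 'f::field) \<Rightarrow> 'j \<Rightarrow> 'f"
  assumes finite: "finite X" "finite X'"
    and add: "T (f + g) = T f + T g"
    and scale: "T (vscale c f) = vscale c (T f)"
    and into: "T f \<in> vecs X'"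
    and vanish: "(\<And>i. i \<in> X \<Longrightarrow> f i = 0) \<Longrightarrow> T f = 0"
    and dot: "dot X' (T f) (T g) = dot X f g"
    and surj: "h \<in> vecs X' \<Longrightarrow> \<exists>f\<in>vecs X. T f = h"
begin

lemma vanish_vecs: "\<lbrakk>f \<in> vecs Y; X \<inter> Y = {}\<rbrakk> \<Longrightarrow> T f = 0"
  by (rule vanish) (auto simp: vecs_def)

lemma minus: "T (- f) = - T f"
  using scale[of "- 1" f] by (simp add: vscale_def fun_Compl_def)

lemma image_minus:
  assumes "subspace_on Y V" shows "(\<lambda>f. - T f) ` V = T ` V"
proof -
  have "(\<lambda>f. - T f) ` V = T ` (uminus ` V)" by (simp add: image_image minus)
  thus ?thesis using uminus_image_subspace[OF assms] by simp
qed

text \<open>An element of the kernel is orthogonal to all of \<open>vecs X\<close>. Its dot product with itself would not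
  suffice, as nonzero isotropic vectors may exist.\<close>

lemma kernel:
  assumes "f \<in> vecs X" "T f = 0" shows "f = 0"
proof -
  have "f \<in> perp X (vecs X)" using assms dot[of f] by (simp add: perp_iff)
  thus ?thesis using perp_vecs finite by blast
qed

lemma inj: "inj_on T (vecs X)"
proof (rule inj_onI)
  fix f g assume fg: "f \<in> vecs X" "g \<in> vecs X" "T f = T g"
  have "f - g = 0"
  proof (rule kernel)
    show "f - g \<in> vecs X" using fg by (auto simp: vecs_def)
    show "T (f - g) = 0" using fg add[of f "- g"] by (simp add: minus)
  qed
  thus "f = g" by simp
qed

lemma image_subspace:
  assumes "subspace_on X V" shows "subspace_on X' (T ` V)"
proof -
  have V: "vecs.subspace V" using assms by (simp add: subspace_on_def)
  have "vecs.subspace (T ` V)"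
  proof (rule vecs.subspaceI)
    show "0 \<in> T ` V"
      using vanish[of 0] vecs.subspace_0[OF V] by (metis image_eqI zero_fun_apply)
    show "f + g \<in> T ` V" if "f \<in> T ` V" "g \<in> T ` V" for f g
      using that vecs.subspace_add[OF V] by (auto simp flip: add)
    show "vscale c f \<in> T ` V" if "f \<in> T ` V" for c f
      using that vecs.subspace_scale[OF V] by (auto simp flip: scale)
  qed
  thus ?thesis using into by (auto simp: subspace_on_def)
qed

lemma perp_image:
  "perp X' (T ` V) = T ` perp X V"
proof (intro equalityI subsetI)
  fix h assume h: "h \<in> perp X' (T ` V)"
  then obtain f where "f \<in> vecs X" "h = T f" using surj by (force simp: perp_iff)
  with h show "h \<in> T ` perp X V" by (auto simp: perp_iff dot)
next
  fix h assume "h \<in> T ` perp X V"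
  thus "h \<in> perp X' (T ` V)" by (auto simp: perp_iff dot into)
qed

lemma image_subset_image_iff:
  "\<lbrakk>U \<subseteq> vecs X; V \<subseteq> vecs X\<rbrakk> \<Longrightarrow> T ` U \<subseteq> T ` V \<longleftrightarrow> U \<subseteq> V"
  using inj_on_image_mem_iff[OF inj, of _ V] unfolding image_subset_iff by blast

lemma image_eq_image_iff:
  "\<lbrakk>U \<subseteq> vecs X; V \<subseteq> vecs X\<rbrakk> \<Longrightarrow> T ` U = T ` V \<longleftrightarrow> U = V"
  using inj by (rule inj_on_image_eq_iff)

text \<open>The common core of the two involution statements: \<open>T\<close> is the relabelling used by an adjoint
  and \<open>S\<close> the one used in the opposite direction.\<close>

lemma adjoint_adjoint:
  assumes S: "\<And>f. f \<in> vecs X \<Longrightarrow> S (T f) = - f" and V: "subspace_on X V"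
  shows "S ` perp X' (T ` perp X V) = V"
proof -
  have "S ` perp X' (T ` perp X V) = (\<lambda>f. S (T f)) ` V"
    using finite V by (simp add: perp_image perp_perp image_image)
  also have "\<dots> = uminus ` V"
    using V S by (intro image_cong) (auto simp: subspace_on_def)
  finally show ?thesis using uminus_image_subspace[OF V] by simp
qed

end

lemma vecs_isometry_uminus:
  fixes T :: "('i \<Rightarrow> 'f::field) \<Rightarrow> 'j \<Rightarrow> 'f"
  assumes "vecs_isometry X X' T" shows "vecs_isometry X X' (\<lambda>f. - T f)"
proof -
  interpret vecs_isometry X X' T by fact
  show ?thesis
  proof
    fix h :: "'j \<Rightarrow> 'f" assume "h \<in> vecs X'"
    then obtain f where f: "f \<in> vecs X" "T f = h" using surj by blast
    show "\<exists>f\<in>vecs X. - T f = h"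
      using f by (intro bexI[of _ "- f"]) (auto simp: minus vecs_def)
  next
    fix f show "- T f \<in> vecs X'" using into[of f] by (auto simp: vecs_def)
  next
    fix f g
    show "dot X' (- T f) (- T g) = dot X f g" using dot[of f g] by (simp add: dot_def)
  qed (use finite vanish in \<open>auto simp: add scale\<close>)
qed

lemma vecs_isometry_sum:
  fixes S T :: "('i \<Rightarrow> 'f::field) \<Rightarrow> 'j \<Rightarrow> 'f"
  assumes S: "vecs_isometry X X' S" and T: "vecs_isometry Y Y' T"
    and disj: "X \<inter> Y = {}" "X' \<inter> Y' = {}"
  shows "vecs_isometry (X \<union> Y) (X' \<union> Y') (\<lambda>f. S f + T f)"
proof -
  interpret S: vecs_isometry X X' S by fact
  interpret T: vecs_isometry Y Y' T by fact
  show ?thesis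
  proof
    fix f g
    show "S (f + g) + T (f + g) = S f + T f + (S g + T g)"
      by (simp add: S.add T.add algebra_simps)
    show "S f + T f \<in> vecs (X' \<union> Y')"
      using S.into[of f] T.into[of f] by (auto simp: vecs_def)
    show "dot (X' \<union> Y') (S f + T f) (S g + T g) = dot (X \<union> Y) f g"
      using S.into[of f] T.into[of f] S.into[of g] T.into[of g] S.finite T.finite disj
      by (simp add: dot_Un dot_add_left dot_add_right dot_disjoint_left dot_disjoint_right
          Int_commute S.dot T.dot)
  next
    fix c f
    show "S (vscale c f) + T (vscale c f) = vscale c (S f + T f)"
      by (simp add: S.scale T.scale vecs.scale_right_distrib)
  next
    fix f :: "'i \<Rightarrow> 'f" assume "\<And>i. i \<in> X \<union> Y \<Longrightarrow> f i = 0"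
    thus "S f + T f = 0" using S.vanish[of f] T.vanish[of f] by simp
  next
    fix h :: "'j \<Rightarrow> 'f" assume h: "h \<in> vecs (X' \<union> Y')"
    obtain f where f: "f \<in> vecs X" "S f = cut X' h" using S.surj[OF cut_in_vecs] by blast
    obtain g where g: "g \<in> vecs Y" "T g = cut Y' h" using T.surj[OF cut_in_vecs] by blast
    have "S g = 0" "T f = 0"
      using S.vanish_vecs[OF g(1)] T.vanish_vecs[OF f(1)] disj by (auto simp: Int_commute)
    hence "S (f + g) + T (f + g) = h"
      using f g cut_add_cut[OF h disj(2)] by (simp add: S.add T.add)
    moreover have "f + g \<in> vecs (X \<union> Y)" using f g by (auto simp: vecs_def)
    ultimately show "\<exists>f\<in>vecs (X \<union> Y). S f + T f = h" by blast
  qed (use S.finite T.finite in auto)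
qed

text \<open>Compositions are natural under relabelling, provided that the composite and the matched
  space are relabelled by the same blocks as the big space.\<close>

lemma matched_comp_image:
  assumes S: "vecs_isometry X X' S" and T: "vecs_isometry Y Y' T"
    and disj: "X \<inter> Y = {}" "X' \<inter> Y' = {}"
    and V: "V \<subseteq> vecs (X \<union> Y)" and K: "K \<subseteq> vecs Y"
  shows "matched_comp X' ((\<lambda>f. S f + T f) ` V) (T ` K) = S ` matched_comp X V K"
proof -
  interpret S: vecs_isometry X X' S by fact
  interpret T: vecs_isometry Y Y' T by fact
  interpret ST: vecs_isometry "X \<union> Y" "X' \<union> Y'" "\<lambda>f. S f + T f"
    by (rule vecs_isometry_sum) fact+
  have ST: "S (f + k) + T (f + k) = S f + T k" if "f \<in> vecs X" "k \<in> K" for f k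
    using that K disj S.vanish_vecs[of k Y] T.vanish_vecs[of f X]
    by (auto simp: S.add T.add Int_commute)
  have fk: "f + k \<in> vecs (X \<union> Y)" if "f \<in> vecs X" "k \<in> K" for f k
    using that K by (force simp: vecs_def)
  have mem: "S f + T k \<in> (\<lambda>f. S f + T f) ` V \<longleftrightarrow> f + k \<in> V" if "f \<in> vecs X" "k \<in> K" for f k
    using inj_on_image_mem_iff[OF ST.inj fk[OF that] V] ST[OF that] by simp
  show ?thesis
  proof (intro equalityI subsetI)
    fix h assume h: "h \<in> matched_comp X' ((\<lambda>f. S f + T f) ` V) (T ` K)"
    then obtain k where k: "k \<in> K" "h + T k \<in> (\<lambda>f. S f + T f) ` V"
      unfolding matched_comp_def by blast
    obtain f where f: "f \<in> vecs X" "S f = h"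
      using S.surj[of h] h unfolding matched_comp_def by blast
    have "f + k \<in> V" using mem[OF f(1) k(1)] k(2) f(2) by simp
    thus "h \<in> S ` matched_comp X V K" using f k(1) unfolding matched_comp_def by blast
  next
    fix h assume "h \<in> S ` matched_comp X V K"
    then obtain f k where f: "h = S f" "f \<in> vecs X" "k \<in> K" "f + k \<in> V"
      unfolding matched_comp_def by blast
    have "h + T k \<in> (\<lambda>f. S f + T f) ` V" using mem[OF f(2,3)] f(1,4) by simp
    thus "h \<in> matched_comp X' ((\<lambda>f. S f + T f) ` V) (T ` K)"
      using f(1,3) S.into[of f] unfolding matched_comp_def by blast
  qed
qed

section \<open>Transport and the signed swap\<close>

lemma transport_at [simp]: "\<lbrakk>inj_on \<phi> X; i \<in> X\<rbrakk> \<Longrightarrow> transport \<phi> X f (\<phi> i) = f i"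
  by (simp add: transport_def)

lemma transport_inv:
  assumes "bij_betw \<phi> X Y"
  shows "transport (inv_into X \<phi>) Y h = (\<lambda>i. if i \<in> X then h (\<phi> i) else 0)"
proof
  fix i
  have *: "inv_into X \<phi> ` Y = X" "inj_on (inv_into X \<phi>) Y"
    using bij_betw_inv_into[OF assms] by (auto simp: bij_betw_def)
  show "transport (inv_into X \<phi>) Y h i = (if i \<in> X then h (\<phi> i) else 0)"
  proof (cases "i \<in> X")
    case True
    thus ?thesis
      using transport_at[OF *(2), of "\<phi> i" h] assms
      by (auto simp: bij_betw_inv_into_left bij_betwE)
  qed (simp add: transport_def *)
qed

lemma vecs_isometry_transport:
  fixes \<phi> :: "'i \<Rightarrow> 'j"
  assumes \<phi>: "bij_betw \<phi> X Y" and "finite X"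
  shows "vecs_isometry X Y (transport \<phi> X :: ('i \<Rightarrow> 'f::field) \<Rightarrow> _)"
proof
  have inj: "inj_on \<phi> X" and Y: "Y = \<phi> ` X" using \<phi> by (auto simp: bij_betw_def)
  show "finite X" "finite Y" using assms Y by auto
  fix f g :: "'i \<Rightarrow> 'f"
  show "transport \<phi> X (f + g) = transport \<phi> X f + transport \<phi> X g"
    by (auto simp: transport_def)
  show "transport \<phi> X (vscale c f) = vscale c (transport \<phi> X f)" for c
    by (auto simp: transport_def vscale_def)
  show "transport \<phi> X f \<in> vecs Y"
    by (auto simp: transport_def vecs_def Y)
  show "transport \<phi> X f = 0" if "\<And>i. i \<in> X \<Longrightarrow> f i = 0"
    using that by (auto simp: transport_def inv_into_into)
  show "dot Y (transport \<phi> X f) (transport \<phi> X g) = dot X f g"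
    unfolding dot_def Y using inj by (simp add: sum.reindex)
  fix h :: "'j \<Rightarrow> 'f" assume h: "h \<in> vecs Y"
  have "transport \<phi> X (cut X (h \<circ> \<phi>)) = h"
  proof
    fix j
    show "transport \<phi> X (cut X (h \<circ> \<phi>)) j = h j"
    proof (cases "j \<in> Y")
      case True
      thus ?thesis using inj Y by (auto simp: cut_def)
    qed (use h Y in \<open>auto simp: transport_def vecs_def\<close>)
  qed
  thus "\<exists>f\<in>vecs X. transport \<phi> X f = h" by (meson cut_in_vecs)
qed

text \<open>The vector-level form of \<open>signed_swap\<close>. As transport from \<open>X\<close> reads only the coordinates in \<open>X\<close>,
  it may be applied to a vector on \<open>X \<union> Y\<close> as a whole.\<close>

definition swap_map :: "'i set \<Rightarrow> 'i set \<Rightarrow> ('i \<Rightarrow> 'j) \<Rightarrow> ('i \<Rightarrow> 'j) \<Rightarrow> ('i \<Rightarrow> 'f::field) \<Rightarrow> 'j \<Rightarrow> 'f"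
  where "swap_map X Y \<phi> \<psi> f = - transport \<phi> X f + transport \<psi> Y f"

lemma vecs_isometry_swap_map:
  assumes "finite X" "finite Y" "X \<inter> Y = {}" "X' \<inter> Y' = {}"
    and "bij_betw \<phi> X Y'" "bij_betw \<psi> Y X'"
  shows "vecs_isometry (X \<union> Y) (X' \<union> Y') (swap_map X Y \<phi> \<psi>)"
proof -
  have "vecs_isometry (X \<union> Y) (Y' \<union> X') (\<lambda>f. - transport \<phi> X f + transport \<psi> Y f)"
    using assms by (intro vecs_isometry_sum vecs_isometry_uminus vecs_isometry_transport) auto
  thus ?thesis by (simp add: swap_map_def[abs_def] Un_commute)
qed

text \<open>Coordinates in \<open>X\<close> are negated by the first swap, those in \<open>Y\<close> by the second. The hypothesis
  constrains \<open>h\<close> only on \<open>X' \<union> Y'\<close>, so that a further block living elsewhere may be added to it.\<close>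

lemma swap_map_swap_map:
  assumes "X \<inter> Y = {}" "X' \<inter> Y' = {}" "bij_betw \<phi> X Y'" "bij_betw \<psi> Y X'"
    and h: "\<And>j. j \<in> X' \<union> Y' \<Longrightarrow> h j = swap_map X Y \<phi> \<psi> f j"
  shows "swap_map X' Y' (inv_into Y \<psi>) (inv_into X \<phi>) h = - cut (X \<union> Y) f"
proof
  fix i
  have *: "\<phi> i \<in> Y'" "transport \<phi> X f (\<phi> i) = f i" "transport \<psi> Y f (\<phi> i) = 0" if "i \<in> X"
    using that assms(2-4) by (auto simp: bij_betw_def transport_def)
  have **: "\<psi> i \<in> X'" "transport \<psi> Y f (\<psi> i) = f i" "transport \<phi> X f (\<psi> i) = 0" if "i \<in> Y"
    using that assms(2-4) by (auto simp: bij_betw_def transport_def)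
  show "swap_map X' Y' (inv_into Y \<psi>) (inv_into X \<phi>) h i = (- cut (X \<union> Y) f) i"
    using assms(1) h[of "\<phi> i"] h[of "\<psi> i"] * **
    by (auto simp: swap_map_def transport_inv[OF assms(3)] transport_inv[OF assms(4)] cut_def)
qed

lemma transport_eq_on: "(\<And>i. i \<in> X \<Longrightarrow> f i = g i) \<Longrightarrow> transport \<phi> X f = transport \<phi> X g"
  by (auto simp: transport_def fun_eq_iff inv_into_into)

lemma signed_swap_eq_image:
  assumes "X \<inter> Y = {}" "V \<subseteq> vecs (X \<union> Y)"
  shows "signed_swap X Y \<phi> \<psi> V = swap_map X Y \<phi> \<psi> ` V"
proof -
  have sum: "swap_map X Y \<phi> \<psi> (f + g) = - transport \<phi> X f + transport \<psi> Y g"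
    if "f \<in> vecs X" "g \<in> vecs Y" for f g
  proof -
    have "transport \<phi> X (f + g) = transport \<phi> X f" "transport \<psi> Y (f + g) = transport \<psi> Y g"
      using that assms(1) by (auto intro!: transport_eq_on simp: vecs_def)
    thus ?thesis by (simp add: swap_map_def)
  qed
  show ?thesis
  proof (intro equalityI subsetI)
    fix h assume "h \<in> signed_swap X Y \<phi> \<psi> V"
    then obtain f g where "f \<in> vecs X" "g \<in> vecs Y" "f + g \<in> V"
      "h = - transport \<phi> X f + transport \<psi> Y g"
      unfolding signed_swap_def by blast
    thus "h \<in> swap_map X Y \<phi> \<psi> ` V" using sum by (metis image_eqI)
  next
    fix h assume "h \<in> swap_map X Y \<phi> \<psi> ` V"
    then obtain v where v: "v \<in> V" "h = swap_map X Y \<phi> \<psi> v" by blast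
    hence "cut X v + cut Y v = v" using assms by (blast intro: cut_add_cut)
    moreover from this have "h = - transport \<phi> X (cut X v) + transport \<psi> Y (cut Y v)"
      using sum[of "cut X v" "cut Y v"] v by simp
    ultimately show "h \<in> signed_swap X Y \<phi> \<psi> V"
      using v(1) cut_in_vecs unfolding signed_swap_def by (smt (verit) mem_Collect_eq)
  qed
qed

section \<open>Adjoints\<close>

lemma genaut_adjoint_eq:
  "W \<inter> Wd = {} \<Longrightarrow>
    genaut_adjoint W Wd \<phi> \<psi> A = swap_map W Wd \<phi> \<psi> ` perp (W \<union> Wd) A"
  by (simp add: genaut_adjoint_def signed_swap_eq_image perp_subset_vecs)

text \<open>The adjoint of a system is formed by two independent signed swaps, one for the states and
  their dotted copies and one for \<open>Mu\<close> and \<open>My\<close>; on vectors their images are added.\<close>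

lemma gds_adjoint_eq:
  assumes "W \<inter> Wd = {}" "(W \<union> Wd) \<inter> Mu = {}" "(W \<union> Wd \<union> Mu) \<inter> My = {}"
  shows "gds_adjoint W Wd Mu My \<phi> \<psi> \<alpha> \<beta> V =
    (\<lambda>f. swap_map W Wd \<phi> \<psi> f + swap_map Mu My \<alpha> \<beta> f) ` perp ((W \<union> Wd) \<union> (Mu \<union> My)) V"
proof -
  let ?J = "\<lambda>f. swap_map W Wd \<phi> \<psi> f + swap_map Mu My \<alpha> \<beta> f"
  let ?P = "perp (W \<union> Wd \<union> Mu \<union> My) V"
  have sum: "?J (f + g + h + k) =
      - transport \<phi> W f + transport \<psi> Wd g - transport \<alpha> Mu h + transport \<beta> My k"
    if "f \<in> vecs W" "g \<in> vecs Wd" "h \<in> vecs Mu" "k \<in> vecs My" for f g h k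
  proof -
    have *: "i \<in> W \<Longrightarrow> i \<notin> Wd \<and> i \<notin> Mu \<and> i \<notin> My"
      "i \<in> Wd \<Longrightarrow> i \<notin> Mu \<and> i \<notin> My" "i \<in> Mu \<Longrightarrow> i \<notin> My" for i
      using assms by blast+
    have "transport \<phi> W (f + g + h + k) = transport \<phi> W f"
      "transport \<psi> Wd (f + g + h + k) = transport \<psi> Wd g"
      "transport \<alpha> Mu (f + g + h + k) = transport \<alpha> Mu h"
      "transport \<beta> My (f + g + h + k) = transport \<beta> My k"
      using that * by (fastforce intro!: transport_eq_on simp: vecs_def)+
    thus ?thesis by (simp add: swap_map_def algebra_simps)
  qed
  have "gds_adjoint W Wd Mu My \<phi> \<psi> \<alpha> \<beta> V = ?J ` ?P"
  proof (intro equalityI subsetI)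
    fix x assume "x \<in> gds_adjoint W Wd Mu My \<phi> \<psi> \<alpha> \<beta> V"
    then obtain f g h k where
        "f \<in> vecs W" "g \<in> vecs Wd" "h \<in> vecs Mu" "k \<in> vecs My" "f + g + h + k \<in> ?P"
        "x = - transport \<phi> W f + transport \<psi> Wd g - transport \<alpha> Mu h + transport \<beta> My k"
      unfolding gds_adjoint_def by blast
    thus "x \<in> ?J ` ?P" using sum[of f g h k] by (metis (no_types, lifting) image_eqI)
  next
    fix x assume "x \<in> ?J ` ?P"
    then obtain v where v: "v \<in> ?P" "x = ?J v" by blast
    have dec: "cut W v + cut Wd v + cut Mu v + cut My v = v"
      using v(1) assms by (auto simp: perp_iff vecs_def cut_def fun_eq_iff)
    hence "x = - transport \<phi> W (cut W v) + transport \<psi> Wd (cut Wd v)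
        - transport \<alpha> Mu (cut Mu v) + transport \<beta> My (cut My v)"
      using sum[of "cut W v" "cut Wd v" "cut Mu v" "cut My v"] v(2) by simp
    moreover have "cut W v + cut Wd v + cut Mu v + cut My v \<in> ?P" using v dec by simp
    ultimately show "x \<in> gds_adjoint W Wd Mu My \<phi> \<psi> \<alpha> \<beta> V"
      unfolding gds_adjoint_def using cut_in_vecs by blast
  qed
  thus ?thesis by (simp add: Un_assoc)
qed

locale adjoint_copies =
  fixes W Wd :: "'i set" and W' Wd' :: "'j set" and \<phi> \<psi> :: "'i \<Rightarrow> 'j"
  assumes finite: "finite W" "finite Wd"
    and disjoint: "W \<inter> Wd = {}" and disjoint': "W' \<inter> Wd' = {}"
    and \<phi>: "bij_betw \<phi> W Wd'" and \<psi>: "bij_betw \<psi> Wd W'"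
begin

sublocale T\<phi>: vecs_isometry W Wd' "transport \<phi> W"
  using \<phi> finite(1) by (rule vecs_isometry_transport)

sublocale T\<psi>: vecs_isometry Wd W' "transport \<psi> Wd"
  using \<psi> finite(2) by (rule vecs_isometry_transport)

sublocale J: vecs_isometry "W \<union> Wd" "W' \<union> Wd'" "swap_map W Wd \<phi> \<psi>"
  using finite disjoint disjoint' \<phi> \<psi> by (rule vecs_isometry_swap_map)

text \<open>The situation is symmetric in the two sides, so each implication proved here about adjoints also
  yields its converse.\<close>

lemma reverse: "adjoint_copies W' Wd' W Wd (inv_into Wd \<psi>) (inv_into W \<phi>)"
  using T\<phi>.finite T\<psi>.finite disjoint disjoint' \<phi> \<psi>
  by unfold_locales (auto simp: bij_betw_inv_into)

lemma subspace_on_adjoint: "subspace_on (W' \<union> Wd') (genaut_adjoint W Wd \<phi> \<psi> A)"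
  by (simp add: genaut_adjoint_eq disjoint J.image_subspace subspace_on_perp)

lemma genaut_adjoint_adjoint:
  assumes A: "subspace_on (W \<union> Wd) A"
  shows "genaut_adjoint W' Wd' (inv_into Wd \<psi>) (inv_into W \<phi>) (genaut_adjoint W Wd \<phi> \<psi> A) = A"
proof -
  have "swap_map W' Wd' (inv_into Wd \<psi>) (inv_into W \<phi>) (swap_map W Wd \<phi> \<psi> f) = - f"
    if "f \<in> vecs (W \<union> Wd)" for f
    using swap_map_swap_map[OF disjoint disjoint' \<phi> \<psi> refl, of f] that by (simp add: cut_id)
  from J.adjoint_adjoint[OF this A] show ?thesis
    by (simp add: genaut_adjoint_eq disjoint disjoint')
qed

text \<open>A swapped vector is supported on \<open>Wd'\<close> exactly if the original is supported on \<open>W\<close>. The minus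
  sign disappears because the contraction is a subspace.\<close>

lemma contraction_swap:
  assumes B: "subspace_on (W \<union> Wd) B"
  shows "contraction Wd' (swap_map W Wd \<phi> \<psi> ` B) = transport \<phi> W ` contraction W B"
    and "contraction W' (swap_map W Wd \<phi> \<psi> ` B) = transport \<psi> Wd ` contraction Wd B"
proof -
  have mem: "swap_map W Wd \<phi> \<psi> b \<in> vecs Wd' \<longleftrightarrow> b \<in> vecs W"
    "swap_map W Wd \<phi> \<psi> b \<in> vecs W' \<longleftrightarrow> b \<in> vecs Wd" if b: "b \<in> B" for b
  proof -
    have bv: "b \<in> vecs (W \<union> Wd)" using b B by (auto simp: subspace_on_def)
    have "swap_map W Wd \<phi> \<psi> b (\<phi> i) = - b i" if "i \<in> W" for i
      using that \<phi> \<psi> disjoint' by (auto simp: swap_map_def transport_def bij_betw_def)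
    moreover have "swap_map W Wd \<phi> \<psi> b (\<psi> i) = b i" if "i \<in> Wd" for i
      using that \<phi> \<psi> disjoint' by (auto simp: swap_map_def transport_def bij_betw_def)
    moreover have "\<phi> i \<notin> W'" if "i \<in> W" for i using that \<phi> disjoint' by (auto simp: bij_betw_def)
    moreover have "\<psi> i \<notin> Wd'" if "i \<in> Wd" for i using that \<psi> disjoint' by (auto simp: bij_betw_def)
    moreover have "swap_map W Wd \<phi> \<psi> b \<in> vecs Wd'" if "b \<in> vecs W"
      using T\<psi>.vanish_vecs[OF that] T\<phi>.into[of b] disjoint
      by (auto simp: swap_map_def vecs_def Int_commute)
    moreover have "swap_map W Wd \<phi> \<psi> b \<in> vecs W'" if "b \<in> vecs Wd"
      using T\<phi>.vanish_vecs[OF that] T\<psi>.into[of b] disjoint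
      by (auto simp: swap_map_def vecs_def)
    ultimately show "swap_map W Wd \<phi> \<psi> b \<in> vecs Wd' \<longleftrightarrow> b \<in> vecs W"
      "swap_map W Wd \<phi> \<psi> b \<in> vecs W' \<longleftrightarrow> b \<in> vecs Wd"
      using bv unfolding vecs_def mem_Collect_eq by (metis UnE neg_equal_0_iff_equal)+
  qed
  have sub: "subspace_on W (contraction W B)"
    using B subspace_vecs vecs.subspace_inter[of "vecs W" B]
    by (auto simp: subspace_on_def contraction_def Collect_conj_eq)
  have "contraction Wd' (swap_map W Wd \<phi> \<psi> ` B) = swap_map W Wd \<phi> \<psi> ` contraction W B"
    using mem(1) by (auto simp: contraction_def)
  also have "\<dots> = (\<lambda>f. - transport \<phi> W f) ` contraction W B"
    using T\<psi>.vanish_vecs[of _ W] disjoint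
    by (intro image_cong) (auto simp: swap_map_def contraction_def Int_commute)
  finally show "contraction Wd' (swap_map W Wd \<phi> \<psi> ` B) = transport \<phi> W ` contraction W B"
    using T\<phi>.image_minus[OF sub] by simp
  have "contraction W' (swap_map W Wd \<phi> \<psi> ` B) = swap_map W Wd \<phi> \<psi> ` contraction Wd B"
    using mem(2) by (auto simp: contraction_def)
  also have "\<dots> = transport \<psi> Wd ` contraction Wd B"
    using T\<phi>.vanish_vecs[of _ Wd] disjoint
    by (intro image_cong) (auto simp: swap_map_def contraction_def)
  finally show "contraction W' (swap_map W Wd \<phi> \<psi> ` B) = transport \<psi> Wd ` contraction Wd B" .
qed

text \<open>With \<open>P\<close> and \<open>Q\<close> the transports from \<open>Wd\<close> to \<open>W\<close> and from \<open>Wd'\<close> to \<open>W'\<close>, being a USG means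
  \<open>P (A \<circ> Wd) \<subseteq> A \<circ> W\<close>. Complements in \<open>W\<close> turn this into \<open>A\<^sup>\<bottom> \<times> W \<subseteq> P (A\<^sup>\<bottom> \<times> Wd)\<close>, and
  applying the injective map \<open>Q \<phi>\<close> turns it into the LSG inclusion for the adjoint, because
  \<open>Q \<phi> P = \<psi>\<close> is the compatibility of the copies.\<close>

lemma usg_iff_lsg_adjoint:
  fixes A :: "('i \<Rightarrow> 'f::field) set"
  assumes \<sigma>: "bij_betw \<sigma> W Wd" and \<sigma>': "bij_betw \<sigma>' W' Wd'"
    and comm: "\<And>w. w \<in> W \<Longrightarrow> \<sigma>' (\<psi> (\<sigma> w)) = \<phi> w"
    and A: "subspace_on (W \<union> Wd) A"
  shows "usg W Wd \<sigma> A \<longleftrightarrow> lsg W' Wd' \<sigma>' (genaut_adjoint W Wd \<phi> \<psi> A)"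
proof -
  let ?B = "perp (W \<union> Wd) A"
  define P :: "('i \<Rightarrow> 'f) \<Rightarrow> 'i \<Rightarrow> 'f" where "P = transport (inv_into W \<sigma>) Wd"
  define Q :: "('j \<Rightarrow> 'f) \<Rightarrow> 'j \<Rightarrow> 'f" where "Q = transport (inv_into W' \<sigma>') Wd'"
  interpret P: vecs_isometry Wd W P
    unfolding P_def using bij_betw_inv_into[OF \<sigma>] finite by (intro vecs_isometry_transport)
  interpret Q: vecs_isometry Wd' W' Q
    unfolding Q_def using bij_betw_inv_into[OF \<sigma>'] T\<phi>.finite by (intro vecs_isometry_transport)
  have RW: "subspace_on W (restriction W Wd A)" and RWd: "subspace_on Wd (restriction Wd W A)"
    using A by (auto intro!: subspace_on_restriction simp: Un_commute)
  have QP: "Q (transport \<phi> W (P f)) = transport \<psi> Wd f" for f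
  proof
    fix j
    show "Q (transport \<phi> W (P f)) j = transport \<psi> Wd f j"
    proof (cases "j \<in> W'")
      case True
      then obtain w where w: "w \<in> W" "j = \<psi> (\<sigma> w)"
        using \<psi> \<sigma> unfolding bij_betw_def by (metis imageE)
      have "\<sigma> w \<in> Wd" using w \<sigma> by (auto simp: bij_betw_def)
      thus ?thesis
        using True w comm \<phi> \<psi>
        by (simp add: Q_def P_def transport_inv[OF \<sigma>] transport_inv[OF \<sigma>'] bij_betw_def)
    next
      case False
      thus ?thesis
        using Q.into[of "transport \<phi> W (P f)"] T\<psi>.into[of f] by (simp add: vecs_def)
    qed
  qed
  have "usg W Wd \<sigma> A \<longleftrightarrow> P ` restriction Wd W A \<subseteq> restriction W Wd A"
    using A by (simp add: usg_def genaut_def P_def)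
  also have "\<dots> \<longleftrightarrow> perp W (restriction W Wd A) \<subseteq> perp W (P ` restriction Wd W A)"
    using perp_subset_iff[OF finite(1) RW P.image_subspace[OF RWd]] by simp
  also have "\<dots> \<longleftrightarrow> contraction W ?B \<subseteq> P ` contraction Wd ?B"
    using perp_restriction[of W Wd A] perp_restriction[of Wd W A] finite disjoint A
    by (simp add: P.perp_image subspace_on_def Un_commute Int_commute)
  also have "\<dots> \<longleftrightarrow> Q ` transport \<phi> W ` contraction W ?B
      \<subseteq> Q ` transport \<phi> W ` P ` contraction Wd ?B"
  proof -
    have "contraction W ?B \<subseteq> vecs W" by (auto simp: contraction_def)
    moreover have "P ` contraction Wd ?B \<subseteq> vecs W" using P.into by blast
    ultimately show ?thesis
      using T\<phi>.into by (subst Q.image_subset_image_iff) (auto simp: T\<phi>.image_subset_image_iff)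
  qed
  also have "Q ` transport \<phi> W ` P ` contraction Wd ?B = transport \<psi> Wd ` contraction Wd ?B"
    by (simp add: image_image QP)
  also have "Q ` transport \<phi> W ` contraction W ?B \<subseteq> \<dots> \<longleftrightarrow>
      lsg W' Wd' \<sigma>' (genaut_adjoint W Wd \<phi> \<psi> A)"
    using subspace_on_adjoint[of A]
    by (simp add: lsg_def genaut_def Q_def genaut_adjoint_eq disjoint
        contraction_swap[OF subspace_on_perp])
  finally show ?thesis .
qed

lemma decoupled_adjoint:
  assumes "decoupled W Wd A"
  shows "decoupled W' Wd' (genaut_adjoint W Wd \<phi> \<psi> A)"
proof -
  obtain V1 V2 where V: "subspace_on W V1" "subspace_on Wd V2" "A = sum_space V1 V2"
    using assms by (auto simp: decoupled_def sum_space_def)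
  let ?U = "perp W V1" and ?V = "perp Wd V2"
  have J: "swap_map W Wd \<phi> \<psi> (f + g) = transport \<psi> Wd g + - transport \<phi> W f"
    if "f \<in> ?U" "g \<in> ?V" for f g
  proof -
    have "f \<in> vecs W" "g \<in> vecs Wd" using that by (auto simp: perp_iff)
    hence "transport \<phi> W g = 0" "transport \<psi> Wd f = 0"
      using T\<phi>.vanish_vecs[of g Wd] T\<psi>.vanish_vecs[of f W] disjoint
      by (auto simp: Int_commute)
    thus ?thesis by (simp add: swap_map_def T\<phi>.add T\<psi>.add)
  qed
  have "genaut_adjoint W Wd \<phi> \<psi> A = swap_map W Wd \<phi> \<psi> ` sum_space ?U ?V"
    using perp_direct_sum[OF finite disjoint V(1,2)] V(3) by (simp add: genaut_adjoint_eq disjoint)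
  also have "\<dots> = sum_space (transport \<psi> Wd ` ?V) ((\<lambda>f. - transport \<phi> W f) ` ?U)"
    unfolding sum_space_def using J by (fastforce simp: image_iff)
  also have "\<dots> = sum_space (transport \<psi> Wd ` ?V) (transport \<phi> W ` ?U)"
    by (simp add: T\<phi>.image_minus[OF subspace_on_perp])
  finally show ?thesis
    unfolding decoupled_def sum_space_def
    using T\<phi>.image_subspace[OF subspace_on_perp] T\<psi>.image_subspace[OF subspace_on_perp] by blast
qed

end

theorem theorem28:
  fixes W Wd Mu My :: "'i set"
    and W' Wd' Mu' My' :: "'j set"
    and \<sigma> :: "'i \<Rightarrow> 'i" and \<sigma>' :: "'j \<Rightarrow> 'j"
    and \<phi> \<psi> \<alpha> \<beta> :: "'i \<Rightarrow> 'j"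
    and V A K :: "('i \<Rightarrow> 'f::field) set"
  assumes finite: "finite W" "finite Wd" "finite Mu" "finite My"
    and disjoint: "W \<inter> Wd = {}" "(W \<union> Wd) \<inter> Mu = {}" "(W \<union> Wd \<union> Mu) \<inter> My = {}"
    and disjoint': "W' \<inter> Wd' = {}" "(W' \<union> Wd') \<inter> Mu' = {}" "(W' \<union> Wd' \<union> Mu') \<inter> My' = {}"
    and copies: "bij_betw \<sigma> W Wd" "bij_betw \<sigma>' W' Wd'"
      "bij_betw \<phi> W Wd'" "bij_betw \<psi> Wd W'" "\<forall>w\<in>W. \<sigma>' (\<psi> (\<sigma> w)) = \<phi> w"
      "bij_betw \<alpha> Mu My'" "bij_betw \<beta> My Mu'"
    and V: "gds W Wd Mu My V"
    and A: "subspace_on (W \<union> Wd) A"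
    and K: "subspace_on (Mu \<union> My) K"
  shows
    "let Va = gds_adjoint W Wd Mu My \<phi> \<psi> \<alpha> \<beta> V;
         Aa = genaut_adjoint W Wd \<phi> \<psi> A
     in V = gds_adjoint W' Wd' Mu' My'
              (inv_into Wd \<psi>) (inv_into W \<phi>) (inv_into My \<beta>) (inv_into Mu \<alpha>) Va \<and>
        (A = matched_comp (W \<union> Wd) V K \<longleftrightarrow>
           Aa = matched_comp (W' \<union> Wd') Va (signed_swap Mu My \<alpha> \<beta> (perp (Mu \<union> My) K))) \<and>
        A = genaut_adjoint W' Wd' (inv_into Wd \<psi>) (inv_into W \<phi>) Aa \<and>
        (usg W Wd \<sigma> A \<longleftrightarrow> lsg W' Wd' \<sigma>' Aa) \<and>
        (genop W Wd \<sigma> A \<longleftrightarrow> genop W' Wd' \<sigma>' Aa) \<and>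
        (decoupled W Wd A \<longleftrightarrow> decoupled W' Wd' Aa)"
proof -
  let ?Va = "gds_adjoint W Wd Mu My \<phi> \<psi> \<alpha> \<beta> V"
  let ?Aa = "genaut_adjoint W Wd \<phi> \<psi> A"
  let ?X = "W \<union> Wd" and ?Y = "Mu \<union> My" and ?X' = "W' \<union> Wd'" and ?Y' = "Mu' \<union> My'"
  have disj: "?X \<inter> ?Y = {}" "?X' \<inter> ?Y' = {}" "Mu \<inter> My = {}" "Mu' \<inter> My' = {}"
    using disjoint disjoint' by blast+
  interpret w: adjoint_copies W Wd W' Wd' \<phi> \<psi>
    using finite disjoint disjoint' copies by unfold_locales
  interpret w': adjoint_copies W' Wd' W Wd "inv_into Wd \<psi>" "inv_into W \<phi>"
    by (rule w.reverse)
  interpret m: adjoint_copies Mu My Mu' My' \<alpha> \<beta>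
    using finite disj copies by unfold_locales
  let ?S = "swap_map W Wd \<phi> \<psi>" and ?T = "swap_map Mu My \<alpha> \<beta>"
  interpret J: vecs_isometry "?X \<union> ?Y" "?X' \<union> ?Y'" "\<lambda>f. ?S f + ?T f"
    using w.J.vecs_isometry_axioms m.J.vecs_isometry_axioms disj(1,2) by (rule vecs_isometry_sum)
  have V': "subspace_on (?X \<union> ?Y) V"
    using V by (simp add: gds_def Un_assoc)
  have Va: "?Va = (\<lambda>f. ?S f + ?T f) ` perp (?X \<union> ?Y) V"
    using disjoint by (rule gds_adjoint_eq)

  \<comment> \<open>Each block of the second swap only reads its own coordinates, so the contribution of the
    other block of the first swap is invisible to it.\<close>
  have 1: "gds_adjoint W' Wd' Mu' My' (inv_into Wd \<psi>) (inv_into W \<phi>) (inv_into My \<beta>)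
      (inv_into Mu \<alpha>) ?Va = V"
    unfolding Va gds_adjoint_eq[OF disjoint']
  proof (rule J.adjoint_adjoint[OF _ V'])
    fix f :: "'i \<Rightarrow> 'f" assume f: "f \<in> vecs (?X \<union> ?Y)"
    let ?S' = "swap_map W' Wd' (inv_into Wd \<psi>) (inv_into W \<phi>)"
    let ?T' = "swap_map Mu' My' (inv_into My \<beta>) (inv_into Mu \<alpha>)"
    have "?T f j = 0" if "j \<in> ?X'" for j
      using m.J.into[of f] that disj by (auto simp: vecs_def)
    hence S': "?S' (?S f + ?T f) = - cut ?X f"
      using disjoint(1) disjoint'(1) copies(3,4) by (intro swap_map_swap_map) auto
    have "?S f j = 0" if "j \<in> ?Y'" for j
      using w.J.into[of f] that disj by (auto simp: vecs_def)
    hence T': "?T' (?S f + ?T f) = - cut ?Y f"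
      using disj(3,4) copies(6,7) by (intro swap_map_swap_map) auto
    have "?S' (?S f + ?T f) + ?T' (?S f + ?T f) = - cut ?X f + - cut ?Y f"
      using S' T' by (rule arg_cong2)
    also have "\<dots> = - (cut ?X f + cut ?Y f)" by simp
    also have "\<dots> = - f" by (simp only: cut_add_cut[OF f disj(1)])
    finally show "?S' (?S f + ?T f) + ?T' (?S f + ?T f) = - f" .
  qed

  have 2: "A = matched_comp ?X V K \<longleftrightarrow>
      ?Aa = matched_comp ?X' ?Va (signed_swap Mu My \<alpha> \<beta> (perp ?Y K))"
  proof -
    have sub: "subspace_on ?X (matched_comp ?X V K)"
      and perp: "perp ?X (matched_comp ?X V K) = matched_comp ?X (perp (?X \<union> ?Y) V) (perp ?Y K)"
      using w.J.finite(1) m.J.finite(1) disj(1) V' K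
      by (rule subspace_on_matched_comp, rule perp_matched_comp)
    have "matched_comp ?X' ?Va (signed_swap Mu My \<alpha> \<beta> (perp ?Y K))
        = matched_comp ?X' ((\<lambda>f. ?S f + ?T f) ` perp (?X \<union> ?Y) V) (?T ` perp ?Y K)"
      using disj by (simp add: Va signed_swap_eq_image perp_subset_vecs)
    also have "\<dots> = ?S ` perp ?X (matched_comp ?X V K)"
      unfolding perp
      using w.J.vecs_isometry_axioms m.J.vecs_isometry_axioms disj(1,2) perp_subset_vecs
        perp_subset_vecs by (rule matched_comp_image)
    finally show ?thesis
      by (simp add: genaut_adjoint_eq[OF disjoint(1)] perp_eq_iff[OF w.J.finite(1) A sub]
          w.J.image_eq_image_iff[OF perp_subset_vecs perp_subset_vecs])
  qed

  have 3: "genaut_adjoint W' Wd' (inv_into Wd \<psi>) (inv_into W \<phi>) ?Aa = A"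
    using A by (rule w.genaut_adjoint_adjoint)

  have 4: "usg W Wd \<sigma> A \<longleftrightarrow> lsg W' Wd' \<sigma>' ?Aa"
    using copies A by (intro w.usg_iff_lsg_adjoint) auto

  \<comment> \<open>The compatibility of the copies also holds with the two sides exchanged, so the duality
    between USGs and LSGs can be applied to the adjoint as well.\<close>
  have "\<sigma> (inv_into W \<phi> (\<sigma>' w')) = inv_into Wd \<psi> w'" if "w' \<in> W'" for w'
  proof -
    have "\<psi> ` \<sigma> ` W = W'" using copies(1,4) by (simp add: bij_betw_def)
    then obtain w where w: "w \<in> W" "w' = \<psi> (\<sigma> w)" using \<open>w' \<in> W'\<close> by blast
    have "\<sigma> w \<in> Wd" using copies(1) w(1) by (rule bij_betw_apply)
    hence "inv_into Wd \<psi> w' = \<sigma> w"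
      using copies(4) by (simp add: w(2) bij_betw_inv_into_left)
    moreover have "\<sigma>' w' = \<phi> w" using bspec[OF copies(5) w(1)] by (simp only: w(2))
    hence "inv_into W \<phi> (\<sigma>' w') = w"
      using copies(3) w(1) by (simp add: bij_betw_inv_into_left)
    ultimately show ?thesis by simp
  qed
  hence 5: "usg W' Wd' \<sigma>' ?Aa \<longleftrightarrow> lsg W Wd \<sigma> A"
    using w'.usg_iff_lsg_adjoint[OF copies(2,1) _ w.subspace_on_adjoint, of A] 3 by simp

  have 6: "decoupled W Wd A \<longleftrightarrow> decoupled W' Wd' ?Aa"
    using w.decoupled_adjoint[of A] w'.decoupled_adjoint[of ?Aa] 3 by auto

  show ?thesis
    unfolding Let_def genop_def
    by (intro conjI 1[symmetric] 2 3[symmetric] 4 6) (use 4 5 in blast)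
qed

end
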